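(* Let $\mathcal{S}_{DCP}$ be the feasible set of the DC optimal power flow problem (defined in the context). Then $\mathcal{S}_{DCP}$ satisfies the globally star shaped (GSS) property: for every $\boldsymbol{p}$ in the projection of $\mathcal{S}_{DCP}$ onto the $\boldsymbol{p}$ variables and every $s\in[0,1]$, the vector $s\boldsymbol{p}$ also lies in this projection. Therefore any optimal solution to the DC optimal power flow problem $$\min\ \sum_{i\in\mathcal{G}_p}c_ip_i^g\quad\text{s.t.}\quad(\boldsymbol{p}^g,\boldsymbol{p})\in\mathcal{M}_{DCP},\quad(\boldsymbol{p},\boldsymbol{\theta},\boldsymbol{p}^l)\in\mathcal{S}_{DCP}$$ is revenue adequate, i.e., $\mathcal{R}=-\lambda^T\boldsymbol{p}\ge0$, where $\lambda$ is the vector of optimal dual variables of the constraints $p_i=p_i^g-d_i$, $i\in\mathcal{N}_p$.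
   Context: A power system is represented by a finite set of nodes $\mathcal{N}_p$ connected by a set of lines $\mathcal{E}_p$, with generators $\mathcal{G}_p$ located at nodes. Given data: loads $d_i$, generator upper bounds $\overline{p}_i^g$, line parameters $Z_{ij}$, line flow limits $\overline{p}_{ij}$, and production costs $c_i$. Variables: generation $\boldsymbol{p}^g=(p_i^g)$, net injections $\boldsymbol{p}=(p_i)_{i\in\mathcal{N}_p}$, nodal voltage phase angles $\boldsymbol{\theta}=(\theta_i)_{i\in\mathcal{N}_p}$, and line power flows $\boldsymbol{p}^l=(p_{ij}^l)_{(ij)\in\mathcal{E}_p}$, with the convention $p_{ji}^l=-p_{ij}^l$. $\partial i\subset\mathcal{N}_p$ is the set of neighbors of node $i$. $$\mathcal{M}_{DCP}=\{(\boldsymbol{p}^g,\boldsymbol{p})\mid p_i=p_i^g-d_i,\ 0\le p_i^g\le\overline{p}_i^g\ \ \forall i\in\mathcal{N}_p\},$$ $$\mathcal{S}_{DCP}=\Big\{(\boldsymbol{p},\boldsymbol{\theta},\boldsymbol{p}^l)\ \Big|\ \sum_{j\in\partial i}p_{ij}^l=p_i\ \forall i\in\mathcal{N}_p;\ \ \theta_i-\theta_j=Z_{ij}p_{ij}^l\ \text{and}\ -\overline{p}_{ij}\le p_{ij}^l\le\overline{p}_{ij}\ \forall(ij)\in\mathcal{E}_p\Big\}.$$ Dual variables and revenue: this is the instance $q=\boldsymbol{p}^g$, $x=\boldsymbol{p}$, $y=(\boldsymbol{\theta},\boldsymbol{p}^l)$ of the problem $\min c(q)$ s.t. $\underline{q}\le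 q\le\overline{q}$, $x=q-d$, $H(x,y)=0$, $G(x,y)\le0$, where $H$ collects the nodal balance and the phase angle equations and $G$ the line flow limits. The Lagrangian is $c(q)+\underline{\mu}^T(\underline{q}-q)+\overline{\mu}^T(q-\overline{q})+\lambda^T(x-q+d)+\nu_i^TG(x,y)+\nu_e^TH(x,y)$ with $\underline{\mu},\overline{\mu},\nu_i\ge0$; the dual variables of an optimal solution are multipliers satisfying the KKT conditions (stationarity in $q,x,y$, dual feasibility and complementary slackness). The net revenue is $\mathcal{R}=\lambda^T(d-q)=-\lambda^Tx$, and revenue adequacy means $\mathcal{R}\ge0$. *)

theory Defs
  imports "HOL-Analysis.Analysis"
begin

text \<open>
  Nodes are the elements of the finite type \<open>'n\<close>. Each line occurs in \<open>lines\<close> exactly once, as a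
  pair \<open>(i, j)\<close> fixing its reference direction; this is what \<open>simple_network\<close> requires, and it also
  excludes loops. No sign is imposed on the loads, the costs or the line data.
\<close>

record 'n dc_network =
  gens :: "'n set"
  lines :: "('n \<times> 'n) set"
  load :: "'n \<Rightarrow> real"
  gen_max :: "'n \<Rightarrow> real"
  line_param :: "'n \<Rightarrow> 'n \<Rightarrow> real"
  line_max :: "'n \<Rightarrow> 'n \<Rightarrow> real"
  cost :: "'n \<Rightarrow> real"

definition simple_network :: "'n dc_network \<Rightarrow> bool" where
  "simple_network N \<longleftrightarrow> (\<forall>i j. (i, j) \<in> lines N \<longrightarrow> (j, i) \<notin> lines N)"

definition neighbors :: "'n dc_network \<Rightarrow> 'n \<Rightarrow> 'n set" where
  "neighbors N i = {j. (i, j) \<in> lines N \<or> (j, i) \<in> lines N}"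

text \<open>
  The line flow variables are the components of \<open>pl\<close> at the pairs in \<open>lines N\<close>; the remaining
  components of \<open>pl\<close> occur in no constraint. \<open>flow N pl i j\<close> is the flow from \<open>i\<close> to \<open>j\<close>,
  with the convention that the flow from \<open>j\<close> to \<open>i\<close> is its negative.
\<close>

definition flow :: "'n::finite dc_network \<Rightarrow> real ^ ('n \<times> 'n) \<Rightarrow> 'n \<Rightarrow> 'n \<Rightarrow> real" where
  "flow N pl i j = (if (i, j) \<in> lines N then pl $ (i, j) else - pl $ (j, i))"

definition M_DCP :: "'n::finite dc_network \<Rightarrow> ((real ^ 'n) \<times> (real ^ 'n)) set" where
  "M_DCP N = {(pg, p). \<forall>i. p $ i = pg $ i - load N i \<and> 0 \<le> pg $ i \<and> pg $ i \<le> gen_max N i}"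

definition S_DCP ::
  "'n::finite dc_network \<Rightarrow> ((real ^ 'n) \<times> (real ^ 'n) \<times> (real ^ ('n \<times> 'n))) set" where
  "S_DCP N = {(p, \<theta>, pl).
     (\<forall>i. (\<Sum>j\<in>neighbors N i. flow N pl i j) = p $ i) \<and>
     (\<forall>(i, j)\<in>lines N.
        \<theta> $ i - \<theta> $ j = line_param N i j * pl $ (i, j) \<and>
        - line_max N i j \<le> pl $ (i, j) \<and> pl $ (i, j) \<le> line_max N i j)}"

definition globally_star_shaped :: "('x::real_vector \<times> 'y) set \<Rightarrow> bool" where
  "globally_star_shaped S \<longleftrightarrow> (\<forall>x\<in>fst ` S. \<forall>s\<in>{0..1::real}. s *\<^sub>R x \<in> fst ` S)"

text \<open>A point is a tuple of generation, net injections, phase angles and line flows.\<close>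

type_synonym 'n dcp_point =
  "(real ^ 'n) \<times> (real ^ 'n) \<times> (real ^ 'n) \<times> (real ^ ('n \<times> 'n))"

definition dcp_feasible :: "'n::finite dc_network \<Rightarrow> 'n dcp_point \<Rightarrow> bool" where
  "dcp_feasible N = (\<lambda>(pg, p, \<theta>, pl). (pg, p) \<in> M_DCP N \<and> (p, \<theta>, pl) \<in> S_DCP N)"

definition dcp_cost :: "'n::finite dc_network \<Rightarrow> 'n dcp_point \<Rightarrow> real" where
  "dcp_cost N = (\<lambda>(pg, p, \<theta>, pl). \<Sum>i\<in>gens N. cost N i * pg $ i)"

definition dcp_optimal :: "'n::finite dc_network \<Rightarrow> 'n dcp_point \<Rightarrow> bool" where
  "dcp_optimal N = is_arg_min (dcp_cost N) (dcp_feasible N)"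

text \<open>
  Multipliers: \<open>mu_lo\<close>, \<open>mu_up\<close> for the generation bounds, \<open>lam\<close> for \<open>p = pg - load\<close>,
  \<open>nu_lo\<close>, \<open>nu_up\<close> for the line flow limits, \<open>nu_bal\<close> for the nodal balances and \<open>nu_ang\<close> for the
  phase angle equations.
\<close>

record 'n dcp_dual =
  mu_lo :: "'n \<Rightarrow> real"
  mu_up :: "'n \<Rightarrow> real"
  lam :: "'n \<Rightarrow> real"
  nu_lo :: "'n \<Rightarrow> 'n \<Rightarrow> real"
  nu_up :: "'n \<Rightarrow> 'n \<Rightarrow> real"
  nu_bal :: "'n \<Rightarrow> real"
  nu_ang :: "'n \<Rightarrow> 'n \<Rightarrow> real"

definition dcp_lagrangian ::
  "'n::finite dc_network \<Rightarrow> 'n dcp_dual \<Rightarrow> 'n dcp_point \<Rightarrow> real" where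
  "dcp_lagrangian N D = (\<lambda>(pg, p, \<theta>, pl).
     dcp_cost N (pg, p, \<theta>, pl)
     + (\<Sum>i\<in>UNIV. mu_lo D i * (0 - pg $ i))
     + (\<Sum>i\<in>UNIV. mu_up D i * (pg $ i - gen_max N i))
     + (\<Sum>i\<in>UNIV. lam D i * (p $ i - pg $ i + load N i))
     + (\<Sum>(i, j)\<in>lines N. nu_lo D i j * (- line_max N i j - pl $ (i, j)))
     + (\<Sum>(i, j)\<in>lines N. nu_up D i j * (pl $ (i, j) - line_max N i j))
     + (\<Sum>i\<in>UNIV. nu_bal D i * ((\<Sum>j\<in>neighbors N i. flow N pl i j) - p $ i))
     + (\<Sum>(i, j)\<in>lines N. nu_ang D i j * (\<theta> $ i - \<theta> $ j - line_param N i j * pl $ (i, j))))"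

definition dcp_stationary ::
  "'n::finite dc_network \<Rightarrow> 'n dcp_dual \<Rightarrow> 'n dcp_point \<Rightarrow> bool" where
  "dcp_stationary N D z \<longleftrightarrow> (dcp_lagrangian N D has_derivative (\<lambda>_. 0)) (at z)"

definition dcp_dual_feasible :: "'n dc_network \<Rightarrow> 'n dcp_dual \<Rightarrow> bool" where
  "dcp_dual_feasible N D \<longleftrightarrow>
     (\<forall>i. 0 \<le> mu_lo D i \<and> 0 \<le> mu_up D i) \<and>
     (\<forall>(i, j)\<in>lines N. 0 \<le> nu_lo D i j \<and> 0 \<le> nu_up D i j)"

definition dcp_compl_slack ::
  "'n::finite dc_network \<Rightarrow> 'n dcp_dual \<Rightarrow> 'n dcp_point \<Rightarrow> bool" where
  "dcp_compl_slack N D = (\<lambda>(pg, p, \<theta>, pl).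
     (\<forall>i. mu_lo D i * (0 - pg $ i) = 0 \<and> mu_up D i * (pg $ i - gen_max N i) = 0) \<and>
     (\<forall>(i, j)\<in>lines N.
        nu_lo D i j * (- line_max N i j - pl $ (i, j)) = 0 \<and>
        nu_up D i j * (pl $ (i, j) - line_max N i j) = 0))"

definition dcp_optimal_dual ::
  "'n::finite dc_network \<Rightarrow> 'n dcp_point \<Rightarrow> 'n dcp_dual \<Rightarrow> bool" where
  "dcp_optimal_dual N z D \<longleftrightarrow>
     dcp_stationary N D z \<and> dcp_dual_feasible N D \<and> dcp_compl_slack N D z"

definition net_revenue :: "'n::finite dc_network \<Rightarrow> 'n dcp_dual \<Rightarrow> real ^ 'n \<Rightarrow> real" where
  "net_revenue N D pg = (\<Sum>i\<in>UNIV. lam D i * (load N i - pg $ i))"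

end

(* The constraints of S_DCP other than the flow limits are homogeneous, and the flow limits are
   symmetric intervals, so S_DCP is invariant under scaling by s in [0,1]. For the revenue,
   differentiate the Lagrangian at the KKT point along s |-> (pg, s p, s theta, s pl): it is affine
   in s, the homogeneous equality constraints contribute nothing to the slope, and stationarity makes
   the slope vanish. Hence - lambda^T p = sum (nu_up - nu_lo) pl, which complementary slackness turns
   into sum (nu_up + nu_lo) line_max >= 0. *)

theory Submission imports Defs begin

lemma flow_scaleR: "flow N (s *\<^sub>R pl) i j = s * flow N pl i j"
  by (simp add: flow_def)

lemma S_DCP_scaleR:
  assumes "(p, \<theta>, pl) \<in> S_DCP N" "0 \<le> s" "s \<le> 1"
  shows "(s *\<^sub>R p, s *\<^sub>R \<theta>, s *\<^sub>R pl) \<in> S_DCP N"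
proof -
  \<comment> \<open>Scaling by \<open>s\<close> in [0,1] does not increase absolute values, so an
    interval symmetric about 0 is preserved.\<close>
  have limits: "- u \<le> s * x \<and> s * x \<le> u" if "- u \<le> x" "x \<le> u" for u x :: real
  proof -
    have "\<bar>s * x\<bar> \<le> \<bar>x\<bar>"
      using assms(2,3) by (simp add: abs_mult mult_left_le_one_le)
    then show ?thesis
      using that by linarith
  qed
  have angle: "s * a - s * b = z * (s * x)" if "a - b = z * x" for a b z x :: real
    using that by (metis mult.left_commute right_diff_distrib)
  have "(\<Sum>j\<in>neighbors N i. flow N (s *\<^sub>R pl) i j) = (s *\<^sub>R p) $ i" for i
    using assms(1) by (simp add: S_DCP_def flow_scaleR flip: sum_distrib_left)
  moreover have "(s *\<^sub>R \<theta>) $ i - (s *\<^sub>R \<theta>) $ j = line_param N i j * (s *\<^sub>R pl) $ (i, j)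
      \<and> - line_max N i j \<le> (s *\<^sub>R pl) $ (i, j) \<and> (s *\<^sub>R pl) $ (i, j) \<le> line_max N i j"
    if "(i, j) \<in> lines N" for i j
  proof -
    from assms(1) that have "\<theta> $ i - \<theta> $ j = line_param N i j * pl $ (i, j)"
      "- line_max N i j \<le> pl $ (i, j)" "pl $ (i, j) \<le> line_max N i j"
      unfolding S_DCP_def by blast+
    then show ?thesis
      unfolding vector_scaleR_component real_scaleR_def using angle limits by blast
  qed
  ultimately show ?thesis
    unfolding S_DCP_def by blast
qed

lemma globally_star_shaped_S_DCP: "globally_star_shaped (S_DCP N)"
  unfolding globally_star_shaped_def
proof (intro ballI)
  fix p and s :: real assume "p \<in> fst ` S_DCP N" "s \<in> {0..1}"
  then obtain \<theta> pl where "(p, \<theta>, pl) \<in> S_DCP N" and "0 \<le> s" "s \<le> 1"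
    by auto
  from S_DCP_scaleR[OF this] show "s *\<^sub>R p \<in> fst ` S_DCP N"
    by (rule image_eqI[rotated]) simp
qed

text \<open>Keeping \<open>pg\<close> fixed freezes the cost and the generation bound terms. The
  nodal balance and phase angle residuals vanish along the whole ray, so \<open>nu_bal\<close> and
  \<open>nu_ang\<close> drop out and only \<open>lam\<close> and the flow limit multipliers enter
  the slope.\<close>

lemma dcp_lagrangian_ray:
  assumes "(p, \<theta>, pl) \<in> S_DCP N"
  shows "dcp_lagrangian N D (pg, s *\<^sub>R p, s *\<^sub>R \<theta>, s *\<^sub>R pl) =
    dcp_lagrangian N D (pg, 0, 0, 0)
    + s * ((\<Sum>i\<in>UNIV. lam D i * p $ i) + (\<Sum>(i, j)\<in>lines N. (nu_up D i j - nu_lo D i j) * pl $ (i, j)))"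
proof -
  have bal: "(\<Sum>j\<in>neighbors N i. flow N (t *\<^sub>R pl) i j) - (t *\<^sub>R p) $ i = 0" for t :: real and i
    using assms by (simp add: S_DCP_def flow_scaleR flip: sum_distrib_left)
  have ang: "(\<Sum>(i, j)\<in>lines N. nu_ang D i j *
      ((t *\<^sub>R \<theta>) $ i - (t *\<^sub>R \<theta>) $ j - line_param N i j * (t *\<^sub>R pl) $ (i, j))) = 0" for t
  proof (intro sum.neutral, clarify)
    fix i j assume "(i, j) \<in> lines N"
    then have "\<theta> $ i - \<theta> $ j = line_param N i j * pl $ (i, j)"
      using assms unfolding S_DCP_def by blast
    then have "t * \<theta> $ i - t * \<theta> $ j = line_param N i j * (t * pl $ (i, j))"
      by (metis mult.left_commute right_diff_distrib)
    then show "nu_ang D i j *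
      ((t *\<^sub>R \<theta>) $ i - (t *\<^sub>R \<theta>) $ j - line_param N i j * (t *\<^sub>R pl) $ (i, j)) = 0"
      by simp
  qed
  have lin: "dcp_lagrangian N D (pg, t *\<^sub>R p, t *\<^sub>R \<theta>, t *\<^sub>R pl) =
      dcp_cost N (pg, 0, 0, 0)
      + (\<Sum>i\<in>UNIV. mu_lo D i * (0 - pg $ i))
      + (\<Sum>i\<in>UNIV. mu_up D i * (pg $ i - gen_max N i))
      + (\<Sum>i\<in>UNIV. lam D i * (load N i - pg $ i))
      - (\<Sum>(i, j)\<in>lines N. (nu_lo D i j + nu_up D i j) * line_max N i j)
      + t * ((\<Sum>i\<in>UNIV. lam D i * p $ i)
        + (\<Sum>(i, j)\<in>lines N. (nu_up D i j - nu_lo D i j) * pl $ (i, j)))" for t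
  proof -
    have "(\<Sum>i\<in>UNIV. lam D i * ((t *\<^sub>R p) $ i - pg $ i + load N i)) =
        (\<Sum>i\<in>UNIV. lam D i * (load N i - pg $ i)) + t * (\<Sum>i\<in>UNIV. lam D i * p $ i)"
      unfolding sum_distrib_left sum.distrib[symmetric]
      by (rule sum.cong) (simp_all add: algebra_simps)
    moreover have "(\<Sum>(i, j)\<in>lines N. nu_lo D i j * (- line_max N i j - (t *\<^sub>R pl) $ (i, j)))
        + (\<Sum>(i, j)\<in>lines N. nu_up D i j * ((t *\<^sub>R pl) $ (i, j) - line_max N i j)) =
        t * (\<Sum>(i, j)\<in>lines N. (nu_up D i j - nu_lo D i j) * pl $ (i, j))
        - (\<Sum>(i, j)\<in>lines N. (nu_lo D i j + nu_up D i j) * line_max N i j)"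
      unfolding sum_distrib_left sum.distrib[symmetric] sum_subtractf[symmetric]
      by (rule sum.cong) (auto simp: algebra_simps)
    ultimately show ?thesis
      unfolding dcp_lagrangian_def dcp_cost_def prod.case bal ang distrib_left by simp
  qed
  \<comment> \<open>The instance at 0 identifies the constant part of \<open>lin\<close> with the
    Lagrangian at \<open>(pg, 0, 0, 0)\<close>.\<close>
  from lin[of s] lin[of 0] show ?thesis
    by simp
qed

text \<open>The ray passes through the KKT point at parameter 1. By the chain rule, the zero
  derivative of the Lagrangian there forces a zero derivative along the ray.\<close>

lemma stationary_ray_slope:
  assumes "dcp_stationary N D (pg, p, \<theta>, pl)" and S: "(p, \<theta>, pl) \<in> S_DCP N"
  shows "(\<Sum>i\<in>UNIV. lam D i * p $ i) +
    (\<Sum>(i, j)\<in>lines N. (nu_up D i j - nu_lo D i j) * pl $ (i, j)) = 0" (is "?b = 0")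
proof -
  define ray where "ray = (\<lambda>s::real. (pg, s *\<^sub>R p, s *\<^sub>R \<theta>, s *\<^sub>R pl))"
  have "(ray has_derivative (\<lambda>h. (0, h *\<^sub>R p, h *\<^sub>R \<theta>, h *\<^sub>R pl))) (at 1)"
    unfolding ray_def by (auto intro!: derivative_eq_intros)
  moreover have "(dcp_lagrangian N D has_derivative (\<lambda>_. 0)) (at (ray 1))"
    using assms(1) by (simp add: dcp_stationary_def ray_def)
  ultimately have "(dcp_lagrangian N D \<circ> ray has_derivative (\<lambda>_. 0)) (at 1)"
    using diff_chain_at by (fastforce simp: o_def)
  moreover have "dcp_lagrangian N D \<circ> ray = (\<lambda>s. dcp_lagrangian N D (pg, 0, 0, 0) + s * ?b)"
    using dcp_lagrangian_ray[OF S] by (auto simp: ray_def)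
  moreover have "((\<lambda>s. dcp_lagrangian N D (pg, 0, 0, 0) + s * ?b) has_derivative (\<lambda>h. h * ?b)) (at 1)"
    by (auto intro!: derivative_eq_intros)
  \<comment> \<open>The chain rule and the affine formula give two derivatives of the same function
    at 1, so they agree; evaluating at \<open>h = 1\<close> isolates the slope.\<close>
  ultimately have "(\<lambda>h. h * ?b) = (\<lambda>_. 0)"
    by (simp add: has_derivative_unique)
  from fun_cong[OF this, of 1] show ?thesis
    by simp
qed

lemma congestion_rent_nonneg:
  assumes S: "(p, \<theta>, pl) \<in> S_DCP N" and "dcp_dual_feasible N D"
    and "dcp_compl_slack N D (pg, p, \<theta>, pl)"
  shows "0 \<le> (\<Sum>(i, j)\<in>lines N. (nu_up D i j - nu_lo D i j) * pl $ (i, j))"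
proof (intro sum_nonneg, clarify)
  fix i j assume ij: "(i, j) \<in> lines N"
  \<comment> \<open>Complementary slackness replaces \<open>pl\<close> by \<open>line_max\<close>
    next to \<open>nu_up\<close> and by \<open>- line_max\<close> next to
    \<open>nu_lo\<close>.\<close>
  have "(nu_up D i j - nu_lo D i j) * pl $ (i, j) = (nu_up D i j + nu_lo D i j) * line_max N i j"
    using assms(3) ij by (fastforce simp: dcp_compl_slack_def algebra_simps)
  \<comment> \<open>The network data do not fix this sign; it follows because a feasible flow lies
    between \<open>- line_max\<close> and \<open>line_max\<close>.\<close>
  moreover have "0 \<le> line_max N i j"
    using S ij by (force simp: S_DCP_def)
  moreover have "0 \<le> nu_up D i j + nu_lo D i j"
    using assms(2) ij by (force simp: dcp_dual_feasible_def)
  ultimately show "0 \<le> (nu_up D i j - nu_lo D i j) * pl $ (i, j)"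
    by simp
qed

lemma net_revenue_eq:
  assumes "(pg, p) \<in> M_DCP N"
  shows "net_revenue N D pg = - (\<Sum>i\<in>UNIV. lam D i * p $ i)"
  using assms by (simp add: net_revenue_def M_DCP_def flip: sum_negf mult_minus_right)

theorem theorem2:
  fixes N :: "'n::finite dc_network"
  assumes "simple_network N"
  shows "globally_star_shaped (S_DCP N)
    \<and> (\<forall>pg p \<theta> pl D.
          dcp_optimal N (pg, p, \<theta>, pl) \<longrightarrow> dcp_optimal_dual N (pg, p, \<theta>, pl) D \<longrightarrow>
            net_revenue N D pg = - (\<Sum>i\<in>UNIV. lam D i * p $ i) \<and> net_revenue N D pg \<ge> 0)"
proof (intro conjI allI impI globally_star_shaped_S_DCP)
  fix pg p \<theta> pl D
  assume "dcp_optimal N (pg, p, \<theta>, pl)" and dual: "dcp_optimal_dual N (pg, p, \<theta>, pl) D"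
  then have M: "(pg, p) \<in> M_DCP N" and S: "(p, \<theta>, pl) \<in> S_DCP N"
    by (simp_all add: dcp_optimal_def is_arg_min_def dcp_feasible_def)
  show eq: "net_revenue N D pg = - (\<Sum>i\<in>UNIV. lam D i * p $ i)"
    using M by (rule net_revenue_eq)
  \<comment> \<open>The zero slope equates the revenue with the congestion rent collected on the
    lines.\<close>
  show "net_revenue N D pg \<ge> 0"
    using stationary_ray_slope[OF _ S] congestion_rent_nonneg[OF S] dual
    unfolding eq dcp_optimal_dual_def by fastforce
qed

end
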